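(* Let $\mathbf A=(A,R,{}')$ be a directed relational system with involution and let $|$ be an operation assigned to $\mathbf A$. Then $|$ is a Sheffer operation on $A$, i.e. $(A,|)$ is a Sheffer groupoid.
   Context: For a binary relation $R$ on a non-empty set $A$ and $a,b\in A$, let $U(a,b):=\{x\in A\mid (a,x),(b,x)\in R\}$ and $L(a,b):=\{x\in A\mid (x,a),(x,b)\in R\}$. A directed relational system with involution is a triple $(A,R,{}')$ where $A$ is a non-empty set, $R$ is a reflexive binary relation on $A$, $U(x,y)\neq\emptyset$ and $L(x,y)\neq\emptyset$ for all $x,y\in A$, and $'$ is a unary operation on $A$ such that $x''=x$ for all $x\in A$ and $(x,y)\in R$ implies $(y',x')\in R$ for all $x,y\in A$. A binary operation $|$ on $A$ is called assigned to $\mathbf A=(A,R,{}')$ if for all $x,y\in A$: $x|y=y'$ if $(x',y')\in R$, and $x|y$ is an (arbitrary) element of $U(x',y')$ otherwise. A Sheffer operation on a non-empty set $A$ is a binary operation $|$ on $A$ satisfying, for all $x,y\in A$, $(x|y)|(x|x)=x$ and $(x|y)|(y|y)=y$; then $(A,|)$ is called a Sheffer groupoid. *)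

theory Defs
  imports Main "HOL-Library.FuncSet"
begin

definition upper_cone :: "'a set \<Rightarrow> 'a rel \<Rightarrow> 'a \<Rightarrow> 'a \<Rightarrow> 'a set" where
  "upper_cone A R a b = {x \<in> A. (a, x) \<in> R \<and> (b, x) \<in> R}"

definition lower_cone :: "'a set \<Rightarrow> 'a rel \<Rightarrow> 'a \<Rightarrow> 'a \<Rightarrow> 'a set" where
  "lower_cone A R a b = {x \<in> A. (x, a) \<in> R \<and> (x, b) \<in> R}"

(* Operations on A are HOL functions that map A into A; their values outside A are irrelevant. *)

definition directed_relational_system_with_involution ::
    "'a set \<Rightarrow> 'a rel \<Rightarrow> ('a \<Rightarrow> 'a) \<Rightarrow> bool" where
  "directed_relational_system_with_involution A R i \<longleftrightarrow>
     A \<noteq> {} \<and> R \<subseteq> A \<times> A \<and> refl_on A R \<and>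
     (\<forall>x\<in>A. \<forall>y\<in>A. upper_cone A R x y \<noteq> {} \<and> lower_cone A R x y \<noteq> {}) \<and>
     i \<in> A \<rightarrow> A \<and>
     (\<forall>x\<in>A. i (i x) = x) \<and>
     (\<forall>x\<in>A. \<forall>y\<in>A. (x, y) \<in> R \<longrightarrow> (i y, i x) \<in> R)"

definition assigned_operation ::
    "'a set \<Rightarrow> 'a rel \<Rightarrow> ('a \<Rightarrow> 'a) \<Rightarrow> ('a \<Rightarrow> 'a \<Rightarrow> 'a) \<Rightarrow> bool" where
  "assigned_operation A R i s \<longleftrightarrow>
     s \<in> A \<rightarrow> A \<rightarrow> A \<and>
     (\<forall>x\<in>A. \<forall>y\<in>A.
        ((i x, i y) \<in> R \<longrightarrow> s x y = i y) \<and>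
        ((i x, i y) \<notin> R \<longrightarrow> s x y \<in> upper_cone A R (i x) (i y)))"

definition sheffer_operation :: "'a set \<Rightarrow> ('a \<Rightarrow> 'a \<Rightarrow> 'a) \<Rightarrow> bool" where
  "sheffer_operation A s \<longleftrightarrow>
     s \<in> A \<rightarrow> A \<rightarrow> A \<and>
     (\<forall>x\<in>A. \<forall>y\<in>A. s (s x y) (s x x) = x \<and> s (s x y) (s y y) = y)"

definition sheffer_groupoid :: "'a set \<Rightarrow> ('a \<Rightarrow> 'a \<Rightarrow> 'a) \<Rightarrow> bool" where
  "sheffer_groupoid A s \<longleftrightarrow> A \<noteq> {} \<and> sheffer_operation A s"

end

theory Submission
  imports Defs
begin

text \<open>
  Writing $x'$ for the involution, both clauses defining an assigned operation place $x|y$ in the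
  upper cone $U(x',y')$: this is explicit when $(x',y') \<notin> R$, and when $(x',y') \<in> R$ the value $y'$
  lies there by reflexivity.  Reflexivity also gives $x|x = x'$.  Applying the involution to the
  relation of $x'$ to $x|y$ yields $((x|y)', x'') \<in> R$, so the product of $x|y$ and $x' = x|x$ falls
  under the first clause and equals $x'' = x$.  As the cone is symmetric in its two generators, the
  same computation recovers $y$.
\<close>

text \<open>The choice made in the second clause is harmless because this is all that one needs to know
  about the value.\<close>

lemma assigned_operation_in_upper_cone:
  assumes "directed_relational_system_with_involution A R i"
    and "assigned_operation A R i s"
    and "x \<in> A" "y \<in> A"
  shows "s x y \<in> upper_cone A R (i x) (i y)"
proof (cases "(i x, i y) \<in> R")
  case True
  have "i y \<in> A"
    using assms unfolding directed_relational_system_with_involution_def by blast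
  moreover have "(i y, i y) \<in> R"
    using assms(1) \<open>i y \<in> A\<close>
    unfolding directed_relational_system_with_involution_def refl_on_def by blast
  moreover have "s x y = i y"
    using assms True unfolding assigned_operation_def by blast
  ultimately show ?thesis
    using True by (simp add: upper_cone_def)
next
  case False
  then show ?thesis
    using assms unfolding assigned_operation_def by blast
qed

lemma assigned_operation_diagonal:
  assumes "directed_relational_system_with_involution A R i"
    and "assigned_operation A R i s"
    and "x \<in> A"
  shows "s x x = i x"
proof -
  have "(i x, i x) \<in> R"
    using assms(1,3)
    unfolding directed_relational_system_with_involution_def refl_on_def by blast
  then show ?thesis
    using assms(2,3) unfolding assigned_operation_def by blast
qed

text \<open>Antitonicity turns a successor $z$ of $x'$ into a predecessor $z'$ of $x''$, which is exactly
  the condition under which the product of $z$ and $x'$ is determined.\<close>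

lemma assigned_operation_absorbs:
  assumes "directed_relational_system_with_involution A R i"
    and "assigned_operation A R i s"
    and "x \<in> A" "z \<in> A" "(i x, z) \<in> R"
  shows "s z (i x) = x"
proof -
  have ix: "i x \<in> A" and ii: "i (i x) = x"
    using assms(1,3) unfolding directed_relational_system_with_involution_def by blast+
  have "(i z, i (i x)) \<in> R"
    using assms(1,4,5) ix unfolding directed_relational_system_with_involution_def by blast
  then have "s z (i x) = i (i x)"
    using assms(2,4) ix unfolding assigned_operation_def by blast
  with ii show ?thesis by simp
qed

theorem theorem3p4:
  fixes A :: "'a set" and R :: "'a rel"
    and i :: "'a \<Rightarrow> 'a" and s :: "'a \<Rightarrow> 'a \<Rightarrow> 'a"
  assumes "directed_relational_system_with_involution A R i"
    and "assigned_operation A R i s"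
  shows "sheffer_groupoid A s"
proof -
  have "s (s x y) (s x x) = x \<and> s (s x y) (s y y) = y" if "x \<in> A" "y \<in> A" for x y
  proof -
    have "s x y \<in> A" "(i x, s x y) \<in> R" "(i y, s x y) \<in> R"
      using assigned_operation_in_upper_cone[OF assms that] by (simp_all add: upper_cone_def)
    then show ?thesis
      using that by (simp add: assigned_operation_diagonal[OF assms]
          assigned_operation_absorbs[OF assms])
  qed
  moreover have "A \<noteq> {}"
    using assms(1) unfolding directed_relational_system_with_involution_def by blast
  moreover have "s \<in> A \<rightarrow> A \<rightarrow> A"
    using assms(2) unfolding assigned_operation_def by blast
  ultimately show ?thesis
    unfolding sheffer_groupoid_def sheffer_operation_def by blast
qed

end
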